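(* Let $E=\{1,\ldots,s\}$. Let the entries of $A=(A_{ij})_{i,j\in E}$ be right-continuous functions of bounded variation with $A(0)=O_s$, and let the entries of $B=(B_{ij})_{i,j\in E}$ be Borel measurable and bounded on compact intervals. Let $h>0$, $T>0$, $t_m=mh$, let $E_d(m)=[A\star B](t_m)-[\Delta A*B_2](m)$, and suppose $t_m\le T$. Then for all $i,j\in E$ $$|E_{d,ij}(m)|\le\omega_B(h;T)\sum_{r\in E}\operatorname{Var}_{[0,T]}(A_{ir}),$$ and consequently $$\|E_d(m)\|_F\le s\,V_A(T)\,\omega_B(h;T).$$ If $B$ is Lipschitz on $[0,T]$ with componentwise constant $L_B(T)$ (that is, $|B_{rj}(t)-B_{rj}(u)|\le L_B(T)|t-u|$ for all $r,j\in E$, $t,u\in[0,T]$), then the right-hand side of the last inequality is bounded by $s\,V_A(T)L_B(T)h$.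
   Context: Functions are defined on $[0,\infty)$. The matrix Stieltjes convolution (Lebesgue–Stieltjes sense) is $[A\star B]_{ij}(t)=\sum_{r\in E}\int_{[0,t]}B_{rj}(t-x)\,dA_{ir}(x)$; since $A(0)=O_s$ there is no mass at $0$. Discretization: $\Delta A(0)=O_s$, $\Delta A(m)=A(t_m)-A(t_{m-1})$ for $m\ge1$, $B_2(m)=\tfrac12\bigl(B(t_{m+1})+B(t_m)\bigr)$, and $[\Delta A*B_2](m)=\sum_{\ell=0}^m\Delta A(\ell)B_2(m-\ell)$. Further, $\omega_B(h;T)=\max_{r,j\in E}\sup\{|B_{rj}(t)-B_{rj}(u)|:0\le t,u\le T,\ |t-u|\le h\}$ and $V_A(T)=\max_{i\in E}\sum_{r\in E}\operatorname{Var}_{[0,T]}(A_{ir})$, where $\operatorname{Var}_{[0,T]}$ is total variation on $[0,T]$. $\|\cdot\|_F$ is the Frobenius norm and $O_s$ the $s\times s$ zero matrix. *)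

theory Defs
  imports "HOL-Analysis.Analysis"
begin

text \<open>
  The index set \<open>E = {1, \<dots>, s}\<close> is a finite type \<open>'s\<close> with \<open>s = CARD('s)\<close>. Functions on
  \<open>[0, \<infinity>)\<close> are total functions on the reals of which only the values at nonnegative
  arguments are used.
\<close>

text \<open>Sums over all partitions \<open>a = p 0 \<le> p 1 \<le> \<dots> \<le> p n = b\<close>.\<close>

definition variation_sums :: "(real \<Rightarrow> real) \<Rightarrow> real \<Rightarrow> real \<Rightarrow> real set" where
  "variation_sums F a b =
     {(\<Sum>k<n. \<bar>F (p (Suc k)) - F (p k)\<bar>) | (p :: nat \<Rightarrow> real) n.
        mono_on {..n} p \<and> p 0 = a \<and> p n = b}"

definition bounded_variation :: "(real \<Rightarrow> real) \<Rightarrow> real \<Rightarrow> real \<Rightarrow> bool" where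
  "bounded_variation F a b \<longleftrightarrow> bdd_above (variation_sums F a b)"

definition total_variation :: "(real \<Rightarrow> real) \<Rightarrow> real \<Rightarrow> real \<Rightarrow> real" where
  "total_variation F a b = Sup (variation_sums F a b)"

text \<open>
  For \<open>F\<close> right-continuous on \<open>[0, \<infinity>)\<close>, of bounded variation on each \<open>[0, T]\<close>, with \<open>F 0 = 0\<close>,
  the functions below are the positive and negative variation of \<open>F\<close>, continued by \<open>0\<close> to the
  negative reals: both are nondecreasing and right-continuous, and \<open>F\<close> is their difference
  (Jordan decomposition). As they vanish on \<open>(-\<infinity>, 0]\<close>, the point \<open>0\<close> carries no mass.
\<close>

definition pos_variation :: "(real \<Rightarrow> real) \<Rightarrow> real \<Rightarrow> real" where
  "pos_variation F x = (if x < 0 then 0 else (total_variation F 0 x + F x) / 2)"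

definition neg_variation :: "(real \<Rightarrow> real) \<Rightarrow> real \<Rightarrow> real" where
  "neg_variation F x = (if x < 0 then 0 else (total_variation F 0 x - F x) / 2)"

definition LS_integral :: "(real \<Rightarrow> real) \<Rightarrow> real set \<Rightarrow> (real \<Rightarrow> real) \<Rightarrow> real" where
  "LS_integral F S f =
     (LINT x:S|interval_measure (pos_variation F). f x)
     - (LINT x:S|interval_measure (neg_variation F). f x)"

definition stieltjes_conv ::
    "(real \<Rightarrow> real^'s^'s) \<Rightarrow> (real \<Rightarrow> real^'s^'s) \<Rightarrow> real \<Rightarrow> real^'s^'s" where
  "stieltjes_conv A B t =
     (\<chi> i j. \<Sum>r\<in>UNIV. LS_integral (\<lambda>x. A x $ i $ r) {0..t} (\<lambda>x. B (t - x) $ r $ j))"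

definition grid :: "real \<Rightarrow> nat \<Rightarrow> real" where
  "grid h m = real m * h"

definition increment :: "real \<Rightarrow> (real \<Rightarrow> real^'s^'s) \<Rightarrow> nat \<Rightarrow> real^'s^'s" where
  "increment h A m = (if m = 0 then 0 else A (grid h m) - A (grid h (m - 1)))"

definition midvalue :: "real \<Rightarrow> (real \<Rightarrow> real^'s^'s) \<Rightarrow> nat \<Rightarrow> real^'s^'s" where
  "midvalue h B m = (1 / 2) *\<^sub>R (B (grid h (m + 1)) + B (grid h m))"

definition discrete_conv ::
    "(nat \<Rightarrow> real^'s^'s) \<Rightarrow> (nat \<Rightarrow> real^'s^'s) \<Rightarrow> nat \<Rightarrow> real^'s^'s" where
  "discrete_conv a b m = (\<Sum>l\<le>m. a l ** b (m - l))"

definition discretization_error ::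
    "real \<Rightarrow> (real \<Rightarrow> real^'s^'s) \<Rightarrow> (real \<Rightarrow> real^'s^'s) \<Rightarrow> nat \<Rightarrow> real^'s^'s" where
  "discretization_error h A B m =
     stieltjes_conv A B (grid h m) - discrete_conv (increment h A) (midvalue h B) m"

definition modulus :: "(real \<Rightarrow> real^'s^'s) \<Rightarrow> real \<Rightarrow> real \<Rightarrow> real" where
  "modulus B h T =
     (MAX (r, j)\<in>UNIV. Sup {\<bar>B t $ r $ j - B u $ r $ j\<bar> | t u.
        0 \<le> t \<and> t \<le> T \<and> 0 \<le> u \<and> u \<le> T \<and> \<bar>t - u\<bar> \<le> h})"

definition max_row_variation :: "(real \<Rightarrow> real^'s^'s) \<Rightarrow> real \<Rightarrow> real" where
  "max_row_variation A T =
     (MAX i\<in>UNIV. \<Sum>r\<in>UNIV. total_variation (\<lambda>x. A x $ i $ r) 0 T)"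

definition frobenius_norm :: "real^'n^'m \<Rightarrow> real" where
  "frobenius_norm M = sqrt (\<Sum>i\<in>UNIV. \<Sum>j\<in>UNIV. \<bar>M $ i $ j\<bar>\<^sup>2)"

lemma frobenius_norm_eq_norm: "frobenius_norm M = norm M"
  by (simp add: frobenius_norm_def norm_vec_def L2_set_def sum_nonneg)

end

theory Submission
  imports Defs
begin

text \<open>
  The point \<open>0\<close> is a null set for both Stieltjes measures attached to an entry of \<open>A\<close>, so
  \<open>[0, t\<^sub>m]\<close> may be cut into the cells \<open>(t\<^sub>l, t\<^sub>l\<^sub>+\<^sub>1]\<close>. For \<open>x\<close> in such a cell, \<open>t\<^sub>m - x\<close> lies
  between the two grid points averaged by the midpoint value \<open>B\<^sub>2(m - l - 1)\<close>, so the integrand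
  differs from that constant by at most the modulus of continuity. Summing over the cells against
  the positive and the negative variation measure gives the modulus times the total variation.
\<close>

section \<open>Partition sums and additivity of the total variation\<close>

lemma variation_sumsI:
  assumes "mono_on {..n} p" "p 0 = a" "p n = b"
  shows "(\<Sum>k<n. \<bar>F (p (Suc k)) - F (p k)\<bar>) \<in> variation_sums F a b"
  using assms unfolding variation_sums_def by blast

lemma abs_diff_in_variation_sums:
  assumes "a \<le> b"
  shows "\<bar>F b - F a\<bar> \<in> variation_sums F a b"
  using variation_sumsI[of 1 "\<lambda>k. if k = 0 then a else b" a b F] assms
  by (auto simp: mono_on_def)

lemma variation_sums_nonempty: "a \<le> b \<Longrightarrow> variation_sums F a b \<noteq> {}"
  using abs_diff_in_variation_sums by blast

text \<open>The two partitions are run through one after the other. This is the superadditive half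
  of the additivity of variation, and it also serves to extend a partition to a larger
  interval.\<close>

lemma variation_sums_concat:
  assumes "u \<in> variation_sums F a b" "v \<in> variation_sums F b c"
  shows "u + v \<in> variation_sums F a c"
proof -
  from assms(1) obtain p n where p: "mono_on {..n} p" "p 0 = a" "p n = b"
    and u: "u = (\<Sum>k<n. \<bar>F (p (Suc k)) - F (p k)\<bar>)"
    unfolding variation_sums_def by blast
  from assms(2) obtain q l where q: "mono_on {..l} q" "q 0 = b" "q l = c"
    and v: "v = (\<Sum>k<l. \<bar>F (q (Suc k)) - F (q k)\<bar>)"
    unfolding variation_sums_def by blast
  define w where "w k = (if k \<le> n then p k else q (k - n))" for k
  \<comment> \<open>At the joint both branches agree, since \<open>p n = b = q 0\<close>; hence the
    shift is valid for \<open>k = 0\<close> too.\<close>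
  have w_shift: "w (n + k) = q k" for k
    using p q by (auto simp: w_def)
  have "mono_on {..n + l} w"
  proof (rule mono_onI)
    fix i j assume ij: "i \<in> {..n + l}" "j \<in> {..n + l}" "i \<le> j"
    show "w i \<le> w j"
    proof (cases "i \<le> n")
      case True
      show ?thesis
      proof (cases "j \<le> n")
        case True
        then show ?thesis using ij p(1) by (auto simp: w_def mono_on_def)
      next
        case False
        have "p i \<le> b" using p \<open>i \<le> n\<close> by (auto simp: mono_on_def)
        also have "b \<le> q (j - n)"
          using q ij False mono_onD[OF q(1), of 0 "j - n"] by auto
        finally show ?thesis using True False by (simp add: w_def)
      qed
    next
      case False
      then show ?thesis using ij mono_onD[OF q(1), of "i - n" "j - n"] by (auto simp: w_def)
    qed
  qed
  moreover have "w 0 = a" "w (n + l) = c"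
    using p q by (auto simp: w_shift) (simp add: w_def)
  ultimately have "(\<Sum>k<n + l. \<bar>F (w (Suc k)) - F (w k)\<bar>) \<in> variation_sums F a c"
    by (rule variation_sumsI)
  also have "(\<Sum>k<n + l. \<bar>F (w (Suc k)) - F (w k)\<bar>)
      = (\<Sum>k<n. \<bar>F (w (Suc k)) - F (w k)\<bar>) + (\<Sum>k<l. \<bar>F (w (n + Suc k)) - F (w (n + k))\<bar>)"
    by (induction l) auto
  also have "(\<Sum>k<n. \<bar>F (w (Suc k)) - F (w k)\<bar>) = u"
    unfolding u by (rule sum.cong) (auto simp: w_def)
  also have "(\<Sum>k<l. \<bar>F (w (n + Suc k)) - F (w (n + k))\<bar>) = v"
    unfolding v w_shift ..
  finally show ?thesis .
qed

text \<open>Clipping every point at \<open>b\<close> from above and from below avoids inserting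
  \<open>b\<close> into the partition. A step on one side of \<open>b\<close> survives in one
  clipped sum and collapses in the other; a step across \<open>b\<close> is handled by the triangle
  inequality through \<open>F b\<close>.\<close>

lemma variation_sums_split:
  assumes "w \<in> variation_sums F a c" "a \<le> b" "b \<le> c"
  obtains u v where "u \<in> variation_sums F a b" "v \<in> variation_sums F b c" "w \<le> u + v"
proof -
  from assms(1) obtain p n where p: "mono_on {..n} p" "p 0 = a" "p n = c"
    and w: "w = (\<Sum>k<n. \<bar>F (p (Suc k)) - F (p k)\<bar>)"
    unfolding variation_sums_def by blast
  define u where "u = (\<Sum>k<n. \<bar>F (min (p (Suc k)) b) - F (min (p k) b)\<bar>)"
  define v where "v = (\<Sum>k<n. \<bar>F (max (p (Suc k)) b) - F (max (p k) b)\<bar>)"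
  have "u \<in> variation_sums F a b" unfolding u_def
    by (rule variation_sumsI) (use p assms in \<open>auto intro!: mono_onI min.mono dest: mono_onD\<close>)
  moreover have "v \<in> variation_sums F b c" unfolding v_def
    by (rule variation_sumsI) (use p assms in \<open>auto intro!: mono_onI max.mono dest: mono_onD\<close>)
  moreover have "w \<le> u + v"
    unfolding w u_def v_def sum.distrib[symmetric]
  proof (rule sum_mono)
    fix k assume "k \<in> {..<n}"
    then have "p k \<le> p (Suc k)" using p(1) by (auto simp: mono_on_def)
    then show "\<bar>F (p (Suc k)) - F (p k)\<bar>
        \<le> \<bar>F (min (p (Suc k)) b) - F (min (p k) b)\<bar> + \<bar>F (max (p (Suc k)) b) - F (max (p k) b)\<bar>"
      by (auto simp: min_def max_def)
  qed
  ultimately show thesis using that by blast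
qed

lemma bounded_variation_subset:
  assumes "bounded_variation F a d" "a \<le> b" "b \<le> c" "c \<le> d"
  shows "bounded_variation F b c"
proof -
  from assms(1) obtain M where M: "\<And>x. x \<in> variation_sums F a d \<Longrightarrow> x \<le> M"
    unfolding bounded_variation_def bdd_above_def by blast
  have "x \<le> M" if "x \<in> variation_sums F b c" for x
  proof -
    \<comment> \<open>A partition of \<open>[b, c]\<close> becomes one of \<open>[a, d]\<close> by
      adding one step on either side, so the bound for \<open>[a, d]\<close> applies.\<close>
    have "\<bar>F b - F a\<bar> + x + \<bar>F d - F c\<bar> \<in> variation_sums F a d"
      using assms abs_diff_in_variation_sums[of a b F] abs_diff_in_variation_sums[of c d F]
      by (intro variation_sums_concat[OF variation_sums_concat[OF _ that]])
    from M[OF this] show ?thesis by linarith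
  qed
  then show ?thesis unfolding bounded_variation_def bdd_above_def by blast
qed

lemma variation_sum_le_total_variation:
  "bounded_variation F a b \<Longrightarrow> x \<in> variation_sums F a b \<Longrightarrow> x \<le> total_variation F a b"
  unfolding bounded_variation_def total_variation_def by (rule cSup_upper)

lemma abs_diff_le_total_variation:
  assumes "bounded_variation F a b" "a \<le> b"
  shows "\<bar>F b - F a\<bar> \<le> total_variation F a b"
  using assms by (intro variation_sum_le_total_variation abs_diff_in_variation_sums)

lemma total_variation_nonneg:
  "bounded_variation F a b \<Longrightarrow> a \<le> b \<Longrightarrow> 0 \<le> total_variation F a b"
  using abs_diff_le_total_variation[of F a b] by linarith

lemma total_variation_refl: "total_variation F a a = 0"
proof -
  have "x = 0" if "x \<in> variation_sums F a a" for x
  proof -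
    from that obtain p n where p: "mono_on {..n} p" "p 0 = a" "p n = a"
      and x: "x = (\<Sum>k<n. \<bar>F (p (Suc k)) - F (p k)\<bar>)"
      unfolding variation_sums_def by blast
    have "p k = a" if "k \<le> n" for k
      using mono_onD[OF p(1), of 0 k] mono_onD[OF p(1), of k n] that p by auto
    then show ?thesis unfolding x by (intro sum.neutral) auto
  qed
  then have "variation_sums F a a = {0}"
    using variation_sums_nonempty[of a a F] by auto
  then show ?thesis by (simp add: total_variation_def)
qed

lemma total_variation_add:
  assumes bv: "bounded_variation F a c" and "a \<le> b" "b \<le> c"
  shows "total_variation F a c = total_variation F a b + total_variation F b c"
proof (rule antisym)
  have ab: "bounded_variation F a b" and bc: "bounded_variation F b c"
    using assms bounded_variation_subset[OF bv] by auto
  show "total_variation F a c \<le> total_variation F a b + total_variation F b c"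
    unfolding total_variation_def[of F a c]
  proof (rule cSup_least)
    show "variation_sums F a c \<noteq> {}" using assms by (intro variation_sums_nonempty) simp
    fix w assume "w \<in> variation_sums F a c"
    then obtain u v where "u \<in> variation_sums F a b" "v \<in> variation_sums F b c" "w \<le> u + v"
      using assms(2,3) by (rule variation_sums_split)
    then show "w \<le> total_variation F a b + total_variation F b c"
      using variation_sum_le_total_variation[OF ab, of u]
        variation_sum_le_total_variation[OF bc, of v] by linarith
  qed
  \<comment> \<open>The two suprema are taken one at a time: over \<open>v\<close> with
    \<open>u\<close> fixed, then over \<open>u\<close>.\<close>
  have "total_variation F a b \<le> total_variation F a c - total_variation F b c"
    unfolding total_variation_def[of F a b]
  proof (rule cSup_least)
    show "variation_sums F a b \<noteq> {}" using assms by (intro variation_sums_nonempty)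
    fix u assume u: "u \<in> variation_sums F a b"
    have "total_variation F b c \<le> total_variation F a c - u"
      unfolding total_variation_def[of F b c]
    proof (rule cSup_least)
      show "variation_sums F b c \<noteq> {}" using assms by (intro variation_sums_nonempty)
      fix v assume "v \<in> variation_sums F b c"
      then have "u + v \<le> total_variation F a c"
        using u by (intro variation_sum_le_total_variation bv variation_sums_concat)
      then show "v \<le> total_variation F a c - u" by simp
    qed
    then show "u \<le> total_variation F a c - total_variation F b c" by simp
  qed
  then show "total_variation F a b + total_variation F b c \<le> total_variation F a c" by simp
qed

lemma total_variation_mono:
  assumes "bounded_variation F a c" "a \<le> b" "b \<le> c"
  shows "total_variation F a b \<le> total_variation F a c"
  using assms total_variation_add[OF assms] bounded_variation_subset[of F a c b c]
    total_variation_nonneg[of F b c] by auto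

lemma variation_sums_uminus: "variation_sums (\<lambda>x. - F x) a b = variation_sums F a b"
  unfolding variation_sums_def by (simp add: abs_minus_commute)

lemma total_variation_uminus: "total_variation (\<lambda>x. - F x) a b = total_variation F a b"
  by (simp add: total_variation_def variation_sums_uminus)

lemma bounded_variation_uminus:
  "bounded_variation (\<lambda>x. - F x) a b \<longleftrightarrow> bounded_variation F a b"
  by (simp add: bounded_variation_def variation_sums_uminus)

section \<open>Right-continuity of the variation\<close>

text \<open>Right-continuity at \<open>t\<close> alone suffices: a point \<open>x\<close> beyond
  \<open>t\<close> is eventually unaffected by the maximum, and for \<open>x = t\<close> the maximum
  is \<open>y\<close> itself. This supplies the termwise limit of a partition sum whose points are
  pushed to the right.\<close>

lemma tendsto_max_at_right:
  fixes F :: "real \<Rightarrow> real"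
  assumes "continuous (at_right t) F" "t \<le> x"
  shows "((\<lambda>y. F (max x y)) \<longlongrightarrow> F x) (at_right t)"
proof (cases "x = t")
  case True
  have "\<forall>\<^sub>F y in at_right t. F y = F (max x y)"
    using eventually_at_right_less[of t] by eventually_elim (simp add: True max_def)
  moreover have "(F \<longlongrightarrow> F x) (at_right t)"
    using assms True by (simp add: continuous_within)
  ultimately show ?thesis by (rule Lim_transform_eventually[rotated])
next
  case False
  have "\<forall>\<^sub>F y in at_right t. F x = F (max x y)"
    using eventually_at_right_real[of t x] assms False
    by (auto elim!: eventually_mono simp: max_def)
  then show ?thesis by (rule Lim_transform_eventually[rotated]) simp
qed

text \<open>
  Pushing the points of an almost optimal partition of \<open>[t, b]\<close> to the right of \<open>y\<close> gives a
  partition of \<open>[y, b]\<close> whose sum tends to the original one as \<open>y\<close> decreases to \<open>t\<close>. Hence the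
  variation over \<open>[y, b]\<close> eventually exhausts the one over \<open>[t, b]\<close>.
\<close>

lemma total_variation_tendsto_0_at_right:
  assumes cont: "continuous (at_right t) F" and bv: "bounded_variation F t b" and "t < b"
  shows "((\<lambda>y. total_variation F t y) \<longlongrightarrow> 0) (at_right t)"
proof (rule tendstoI)
  fix e :: real assume "0 < e"
  then have "total_variation F t b - e < Sup (variation_sums F t b)"
    by (simp add: total_variation_def)
  then obtain w where "w \<in> variation_sums F t b" and w: "total_variation F t b - e < w"
    using less_cSupE variation_sums_nonempty[of t b F] \<open>t < b\<close> by (metis less_imp_le)
  then obtain p n where p: "mono_on {..n} p" "p 0 = t" "p n = b"
    and w_eq: "w = (\<Sum>k<n. \<bar>F (p (Suc k)) - F (p k)\<bar>)"
    unfolding variation_sums_def by blast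
  define G where "G y = (\<Sum>k<n. \<bar>F (max (p (Suc k)) y) - F (max (p k) y)\<bar>)" for y
  have "t \<le> p k" if "k \<le> n" for k
    using mono_onD[OF p(1), of 0 k] that p by auto
  then have "(G \<longlongrightarrow> w) (at_right t)"
    unfolding G_def w_eq
    by (intro tendsto_sum tendsto_rabs tendsto_diff tendsto_max_at_right[OF cont]) auto
  then have "\<forall>\<^sub>F y in at_right t. total_variation F t b - e < G y"
    using w by (rule order_tendstoD)
  moreover have "\<forall>\<^sub>F y in at_right t. y \<in> {t<..<b}"
    using \<open>t < b\<close> by (rule eventually_at_right_real)
  ultimately show "\<forall>\<^sub>F y in at_right t. dist (total_variation F t y) 0 < e"
  proof eventually_elim
    case (elim y)
    have "G y \<in> variation_sums F y b"
      unfolding G_def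
      by (rule variation_sumsI) (use p elim in \<open>auto intro!: mono_onI max.mono dest: mono_onD\<close>)
    then have "G y \<le> total_variation F y b"
      using elim by (intro variation_sum_le_total_variation bounded_variation_subset[OF bv]) auto
    moreover have "0 \<le> total_variation F t y"
      using elim by (intro total_variation_nonneg bounded_variation_subset[OF bv]) auto
    moreover have "total_variation F t b = total_variation F t y + total_variation F y b"
      using elim by (intro total_variation_add bv) auto
    ultimately show ?case using elim by simp
  qed
qed

section \<open>The Jordan components as distribution functions\<close>

text \<open>Total variation ignores the sign of \<open>F\<close>, so facts about the positive
  variation carry over to the negative one by passing to \<open>-F\<close>.\<close>

lemma neg_variation_eq: "neg_variation F = pos_variation (\<lambda>x. - F x)"
  by (simp add: fun_eq_iff neg_variation_def pos_variation_def total_variation_uminus)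

text \<open>The variation over \<open>[x, y]\<close> dominates the change of \<open>F\<close> there,
  so a decrease of \<open>F\<close> is always compensated. When \<open>x < 0 \<le> y\<close>, the
  same bound from \<open>0\<close> to \<open>y\<close> with \<open>F 0 = 0\<close> makes the value
  at \<open>y\<close> nonnegative.\<close>

lemma mono_pos_variation:
  assumes bv: "\<And>b. 0 \<le> b \<Longrightarrow> bounded_variation F 0 b" and "F 0 = 0"
  shows "mono (pos_variation F)"
proof (rule monoI)
  fix x y :: real assume "x \<le> y"
  consider "y < 0" | "x < 0" "0 \<le> y" | "0 \<le> x" by linarith
  then show "pos_variation F x \<le> pos_variation F y"
  proof cases
    case 2
    then have "0 \<le> total_variation F 0 y + F y"
      using abs_diff_le_total_variation[OF bv, of y] \<open>F 0 = 0\<close> by auto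
    with 2 show ?thesis by (simp add: pos_variation_def)
  next
    case 3
    then have "total_variation F 0 y = total_variation F 0 x + total_variation F x y"
      using \<open>x \<le> y\<close> by (intro total_variation_add bv) auto
    moreover have "\<bar>F y - F x\<bar> \<le> total_variation F x y"
      using 3 \<open>x \<le> y\<close>
      by (intro abs_diff_le_total_variation bounded_variation_subset[OF bv[of y]]) auto
    ultimately show ?thesis using 3 \<open>x \<le> y\<close> by (simp add: pos_variation_def)
  qed (use \<open>x \<le> y\<close> in \<open>simp add: pos_variation_def\<close>)
qed

text \<open>For \<open>t \<ge> 0\<close>, additivity reduces the claim to the vanishing of the
  variation over \<open>[t, y]\<close> as \<open>y\<close> decreases to \<open>t\<close>. Together
  with monotonicity this lets \<open>interval_measure\<close> give each half-open interval the
  increment as its mass.\<close>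

lemma right_continuous_pos_variation:
  assumes bv: "\<And>b. 0 \<le> b \<Longrightarrow> bounded_variation F 0 b"
    and cont: "\<And>t. 0 \<le> t \<Longrightarrow> continuous (at_right t) F"
  shows "continuous (at_right t) (pos_variation F)"
proof (cases "t < 0")
  case True
  then have "\<forall>\<^sub>F y in at_right t. 0 = pos_variation F y"
    using eventually_at_right_real[of t 0]
    by (auto elim!: eventually_mono simp: pos_variation_def)
  then have "(pos_variation F \<longlongrightarrow> 0) (at_right t)"
    by (rule Lim_transform_eventually[rotated]) simp
  then show ?thesis using True by (simp add: continuous_within pos_variation_def)
next
  case False
  have "((\<lambda>y. total_variation F t y) \<longlongrightarrow> 0) (at_right t)"
    using False
    by (intro total_variation_tendsto_0_at_right[of _ _ "t + 1"] cont
        bounded_variation_subset[OF bv[of "t + 1"]]) auto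
  then have "((\<lambda>y. (total_variation F 0 t + total_variation F t y + F y) / 2)
      \<longlongrightarrow> (total_variation F 0 t + 0 + F t) / 2) (at_right t)"
    using cont[of t] False by (intro tendsto_intros) (auto simp: continuous_within)
  moreover have "\<forall>\<^sub>F y in at_right t.
      (total_variation F 0 t + total_variation F t y + F y) / 2 = pos_variation F y"
    using eventually_at_right_less[of t]
  proof eventually_elim
    case (elim y)
    then have "total_variation F 0 y = total_variation F 0 t + total_variation F t y"
      using False by (intro total_variation_add bv) auto
    then show ?case using elim False by (simp add: pos_variation_def)
  qed
  ultimately have "(pos_variation F \<longlongrightarrow> (total_variation F 0 t + 0 + F t) / 2) (at_right t)"
    by (rule Lim_transform_eventually)
  then show ?thesis using False by (simp add: continuous_within pos_variation_def)
qed

section \<open>Stieltjes integrals of functions close to a step function\<close>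

text \<open>On a set of finite measure constants are integrable, so \<open>f\<close> is dominated by
  \<open>\<bar>c\<bar> + w\<close> and its integral is squeezed between those of
  \<open>c - w\<close> and \<open>c + w\<close>.\<close>

lemma set_integral_near_const:
  fixes f :: "'a \<Rightarrow> real"
  assumes S: "S \<in> sets M" "emeasure M S < \<infinity>" and f: "f \<in> borel_measurable M"
    and near: "\<And>x. x \<in> S \<Longrightarrow> \<bar>f x - c\<bar> \<le> w"
  shows "set_integrable M S f"
    and "\<bar>(LINT x:S|M. f x) - c * measure M S\<bar> \<le> w * measure M S"
proof -
  have const: "set_integrable M S (\<lambda>_. a)" for a :: real
    using S by (simp add: set_integrable_def)
  show int: "set_integrable M S f"
  proof (rule set_integrable_bound[OF const[of "\<bar>c\<bar> + w"]])
    show "set_borel_measurable M S f"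
      using S f by (auto simp: set_borel_measurable_def)
    show "AE x in M. x \<in> S \<longrightarrow> norm (f x) \<le> norm (\<bar>c\<bar> + w)"
    proof (intro AE_I2 impI)
      fix x assume "x \<in> S"
      from near[OF this] show "norm (f x) \<le> norm (\<bar>c\<bar> + w)"
        unfolding real_norm_def by linarith
    qed
  qed
  have const_eq: "(LINT x:S|M. a) = a * measure M S" for a :: real
    using S by (simp add: set_lebesgue_integral_def)
  have "c - w \<le> f x" "f x \<le> c + w" if "x \<in> S" for x
    using near[OF that] by auto
  then have "(LINT x:S|M. c - w) \<le> (LINT x:S|M. f x)" "(LINT x:S|M. f x) \<le> (LINT x:S|M. c + w)"
    using set_integral_mono[OF const int] set_integral_mono[OF int const] by blast+
  then show "\<bar>(LINT x:S|M. f x) - c * measure M S\<bar> \<le> w * measure M S"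
    unfolding const_eq by (simp add: algebra_simps abs_le_iff)
qed

text \<open>The half-open cells are disjoint and their masses are the increments of
  \<open>G\<close>, so the errors add up to a telescoping sum. Integrability is part of the
  induction because additivity of the integral over the union requires it.\<close>

lemma set_integral_interval_measure_near_step:
  fixes G f :: "real \<Rightarrow> real" and p :: "nat \<Rightarrow> real"
  assumes G: "mono G" "\<And>x. continuous (at_right x) G"
    and f: "f \<in> borel_measurable borel" and p: "mono p"
    and near: "\<And>l x. l < n \<Longrightarrow> x \<in> {p l<..p (Suc l)} \<Longrightarrow> \<bar>f x - c l\<bar> \<le> w"
  shows "set_integrable (interval_measure G) {p 0<..p n} f
    \<and> \<bar>(LINT x:{p 0<..p n}|interval_measure G. f x) - (\<Sum>l<n. c l * (G (p (Suc l)) - G (p l)))\<bar>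
      \<le> w * (G (p n) - G (p 0))"
  using near
proof (induction n)
  case 0
  show ?case by (simp add: set_lebesgue_integral_def)
next
  case (Suc n)
  let ?M = "interval_measure G" and ?S = "{p n<..p (Suc n)}"
  have le: "p 0 \<le> p n" "p n \<le> p (Suc n)"
    using p by (auto simp: mono_def)
  have meas: "measure ?M ?S = G (p (Suc n)) - G (p n)"
    using G le by (intro measure_interval_measure_Ioc) (auto simp: mono_def)
  have "emeasure ?M ?S < \<infinity>"
    using G by (subst emeasure_interval_measure_Ioc_eq) (auto simp: mono_def)
  then have cell: "set_integrable ?M ?S f"
    "\<bar>(LINT x:?S|?M. f x) - c n * measure ?M ?S\<bar> \<le> w * measure ?M ?S"
    using f Suc.prems[of n] set_integral_near_const[of ?S ?M f "c n" w] by simp_all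
  have IH: "set_integrable ?M {p 0<..p n} f"
    "\<bar>(LINT x:{p 0<..p n}|?M. f x) - (\<Sum>l<n. c l * (G (p (Suc l)) - G (p l)))\<bar>
      \<le> w * (G (p n) - G (p 0))"
    using Suc.IH Suc.prems by simp_all
  have Un: "{p 0<..p (Suc n)} = {p 0<..p n} \<union> ?S"
    using le by auto
  have "(LINT x:{p 0<..p (Suc n)}|?M. f x) = (LINT x:{p 0<..p n}|?M. f x) + (LINT x:?S|?M. f x)"
    unfolding Un using IH(1) cell(1) by (intro set_integral_Un) auto
  moreover have "set_integrable ?M {p 0<..p (Suc n)} f"
    unfolding Un using IH(1) cell(1) by (intro set_integrable_Un) auto
  moreover have "w * (G (p (Suc n)) - G (p 0))
      = w * (G (p n) - G (p 0)) + w * (G (p (Suc n)) - G (p n))"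
    by (simp add: algebra_simps)
  ultimately show ?case
    using IH(2) cell(2) unfolding meas by simp
qed

lemma set_integral_pos_variation_near_step:
  fixes F f :: "real \<Rightarrow> real" and p :: "nat \<Rightarrow> real"
  assumes bv: "\<And>b. 0 \<le> b \<Longrightarrow> bounded_variation F 0 b" and "F 0 = 0"
    and cont: "\<And>t. 0 \<le> t \<Longrightarrow> continuous (at_right t) F"
    and f: "f \<in> borel_measurable borel" and p: "mono p" "p 0 = 0"
    and near: "\<And>l x. l < n \<Longrightarrow> x \<in> {p l<..p (Suc l)} \<Longrightarrow> \<bar>f x - c l\<bar> \<le> w"
  shows "\<bar>(LINT x:{0..p n}|interval_measure (pos_variation F). f x)
      - (\<Sum>l<n. c l * (pos_variation F (p (Suc l)) - pos_variation F (p l)))\<bar>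
    \<le> w * pos_variation F (p n)"
proof -
  let ?G = "pos_variation F" and ?M = "interval_measure (pos_variation F)"
  have G: "mono ?G" "\<And>x. continuous (at_right x) ?G"
    using mono_pos_variation[OF bv] right_continuous_pos_variation[OF bv cont] \<open>F 0 = 0\<close> by auto
  have G0: "?G 0 = 0"
    by (simp add: pos_variation_def total_variation_refl \<open>F 0 = 0\<close>)
  \<comment> \<open>The positive variation vanishes at both ends of this interval. Thus
    \<open>0\<close> is an atom of mass zero and the closed interval may be replaced by the
    half-open one that the cells cover.\<close>
  have "emeasure ?M {-1<..0} = 0"
    using G by (subst emeasure_interval_measure_Ioc) (auto simp: mono_def G0, simp add: pos_variation_def)
  then have "{-1<..0} \<in> null_sets ?M" by auto
  then have "{0} \<in> null_sets ?M" by (rule null_sets_subset) auto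
  then have AE: "AE x in ?M. x \<noteq> 0"
    using AE_not_in by fastforce
  have "(LINT x:{0..p n}|?M. f x) = (LINT x:{0<..p n}|?M. f x)"
  proof (rule set_integral_cong_set)
    show "AE x in ?M. (x \<in> {0<..p n}) = (x \<in> {0..p n})"
      using AE by eventually_elim auto
  qed (use f in \<open>auto simp: set_borel_measurable_def\<close>)
  then show ?thesis
    using set_integral_interval_measure_near_step[OF G f p(1) near, of n] p(2) G0 by auto
qed

text \<open>The integral against \<open>F\<close> is the difference of those against the two Jordan
  components, but their errors add. The sum of the components is the total variation, which
  therefore appears in the bound.\<close>

lemma LS_integral_near_step:
  fixes F f :: "real \<Rightarrow> real" and p :: "nat \<Rightarrow> real"
  assumes bv: "\<And>b. 0 \<le> b \<Longrightarrow> bounded_variation F 0 b" and "F 0 = 0"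
    and cont: "\<And>t. 0 \<le> t \<Longrightarrow> continuous (at_right t) F"
    and f: "f \<in> borel_measurable borel" and p: "mono p" "p 0 = 0"
    and near: "\<And>l x. l < n \<Longrightarrow> x \<in> {p l<..p (Suc l)} \<Longrightarrow> \<bar>f x - c l\<bar> \<le> w"
  shows "\<bar>LS_integral F {0..p n} f - (\<Sum>l<n. c l * (F (p (Suc l)) - F (p l)))\<bar>
    \<le> w * total_variation F 0 (p n)"
proof -
  have p_nonneg: "0 \<le> p l" for l
    using p monoD[of p 0 l] by simp
  let ?P = "pos_variation F" and ?N = "neg_variation F"
  have "\<bar>(LINT x:{0..p n}|interval_measure ?P. f x)
      - (\<Sum>l<n. c l * (?P (p (Suc l)) - ?P (p l)))\<bar> \<le> w * ?P (p n)"
    using assms by (intro set_integral_pos_variation_near_step) auto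
  moreover have "\<bar>(LINT x:{0..p n}|interval_measure ?N. f x)
      - (\<Sum>l<n. c l * (?N (p (Suc l)) - ?N (p l)))\<bar> \<le> w * ?N (p n)"
    unfolding neg_variation_eq
    using assms
    by (intro set_integral_pos_variation_near_step)
       (auto simp: bounded_variation_uminus intro: continuous_minus)
  moreover have F_eq: "F (p l) = ?P (p l) - ?N (p l)" for l
    using p_nonneg[of l] by (simp add: pos_variation_def neg_variation_def field_simps)
  have "(\<Sum>l<n. c l * (F (p (Suc l)) - F (p l)))
      = (\<Sum>l<n. c l * (?P (p (Suc l)) - ?P (p l))) - (\<Sum>l<n. c l * (?N (p (Suc l)) - ?N (p l)))"
    unfolding F_eq by (simp add: sum_subtractf[symmetric] algebra_simps)
  moreover have "total_variation F 0 (p n) = ?P (p n) + ?N (p n)"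
    using p_nonneg[of n] by (simp add: pos_variation_def neg_variation_def field_simps)
  then have "w * total_variation F 0 (p n) = w * ?P (p n) + w * ?N (p n)"
    by (simp add: distrib_left)
  ultimately show ?thesis
    unfolding LS_integral_def by linarith
qed

lemma LS_integral_cong:
  "(\<And>x. x \<in> S \<Longrightarrow> f x = g x) \<Longrightarrow> S \<in> sets borel \<Longrightarrow> LS_integral F S f = LS_integral F S g"
  unfolding LS_integral_def
  by (intro arg_cong2[of _ _ _ _ "(-)"] set_lebesgue_integral_cong) auto

section \<open>The modulus of continuity and the discrete convolution\<close>

text \<open>Boundedness of the entries on \<open>[0, T]\<close> bounds the differences from above,
  which makes \<open>Sup\<close> in the modulus a genuine supremum.\<close>

lemma abs_diff_le_modulus:
  fixes B :: "real \<Rightarrow> real^'s^'s"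
  assumes bdd: "\<And>i j. bounded ((\<lambda>x. B x $ i $ j) ` {0..T})"
    and "t \<in> {0..T}" "u \<in> {0..T}" "\<bar>t - u\<bar> \<le> h"
  shows "\<bar>B t $ r $ j - B u $ r $ j\<bar> \<le> modulus B h T"
proof -
  define D where "D r j = {\<bar>B t $ r $ j - B u $ r $ j\<bar> | t u.
        0 \<le> t \<and> t \<le> T \<and> 0 \<le> u \<and> u \<le> T \<and> \<bar>t - u\<bar> \<le> h}" for r j
  obtain M where M: "\<And>x. x \<in> {0..T} \<Longrightarrow> \<bar>B x $ r $ j\<bar> \<le> M"
    using bdd[of r j] unfolding bounded_iff real_norm_def by blast
  have "bdd_above (D r j)"
  proof (rule bdd_aboveI)
    fix d assume "d \<in> D r j"
    then obtain t u where "d = \<bar>B t $ r $ j - B u $ r $ j\<bar>" "t \<in> {0..T}" "u \<in> {0..T}"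
      by (auto simp: D_def)
    then show "d \<le> 2 * M" using M[of t] M[of u] by linarith
  qed
  moreover have "\<bar>B t $ r $ j - B u $ r $ j\<bar> \<in> D r j"
    using assms by (auto simp: D_def)
  ultimately have "\<bar>B t $ r $ j - B u $ r $ j\<bar> \<le> Sup (D r j)"
    by (rule cSup_upper[rotated])
  also have "\<dots> \<le> modulus B h T"
    unfolding modulus_def D_def by (rule Max_ge) auto
  finally show ?thesis .
qed

lemma modulus_le:
  fixes B :: "real \<Rightarrow> real^'s^'s"
  assumes "0 \<le> T" "0 \<le> h"
    and le: "\<And>r j t u. t \<in> {0..T} \<Longrightarrow> u \<in> {0..T} \<Longrightarrow> \<bar>t - u\<bar> \<le> h \<Longrightarrow> \<bar>B t $ r $ j - B u $ r $ j\<bar> \<le> w"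
  shows "modulus B h T \<le> w"
proof -
  have "Sup {\<bar>B t $ r $ j - B u $ r $ j\<bar> | t u.
        0 \<le> t \<and> t \<le> T \<and> 0 \<le> u \<and> u \<le> T \<and> \<bar>t - u\<bar> \<le> h} \<le> w" for r j
  proof (rule cSup_least)
    \<comment> \<open>The choice \<open>t = u = 0\<close> shows that the supremum is over a nonempty
      set.\<close>
    have "\<bar>B 0 $ r $ j - B 0 $ r $ j\<bar> \<in> {\<bar>B t $ r $ j - B u $ r $ j\<bar> | t u.
        0 \<le> t \<and> t \<le> T \<and> 0 \<le> u \<and> u \<le> T \<and> \<bar>t - u\<bar> \<le> h}"
      using assms(1,2) by force
    then show "{\<bar>B t $ r $ j - B u $ r $ j\<bar> | t u.
        0 \<le> t \<and> t \<le> T \<and> 0 \<le> u \<and> u \<le> T \<and> \<bar>t - u\<bar> \<le> h} \<noteq> {}" by blast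
  qed (use le in force)
  then show ?thesis unfolding modulus_def by (intro Max.boundedI) auto
qed

text \<open>The increment at index \<open>0\<close> is zero, so the sum shifts by one and is indexed
  by the cells, from \<open>grid h l\<close> to \<open>grid h (Suc l)\<close>. This is the
  step-function sum used in the integral estimate.\<close>

lemma discrete_conv_increment_component:
  "discrete_conv (increment h A) b m $ i $ j
    = (\<Sum>r\<in>UNIV. \<Sum>l<m. b (m - Suc l) $ r $ j * (A (grid h (Suc l)) $ i $ r - A (grid h l) $ i $ r))"
proof -
  have "discrete_conv (increment h A) b m = (\<Sum>l<Suc m. increment h A l ** b (m - l))"
    by (simp add: discrete_conv_def lessThan_Suc_atMost)
  also have "\<dots> = (\<Sum>l<m. increment h A (Suc l) ** b (m - Suc l))"
    unfolding sum.lessThan_Suc_shift by (simp add: increment_def)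
  finally show ?thesis
    by (subst sum.swap) (simp add: sum_component matrix_matrix_mult_def increment_def mult.commute)
qed

lemma midvalue_near:
  fixes B :: "real \<Rightarrow> real^'s^'s"
  assumes bdd: "\<And>i j. bounded ((\<lambda>x. B x $ i $ j) ` {0..T})" and "0 < h" and "grid h m \<le> T"
    and "l < m" and x: "x \<in> {grid h l<..grid h (Suc l)}"
  shows "\<bar>B (grid h m - x) $ r $ j - midvalue h B (m - Suc l) $ r $ j\<bar> \<le> modulus B h T"
proof -
  \<comment> \<open>The reflection of \<open>x\<close> to \<open>grid h m - x\<close> turns cell
    \<open>l\<close>, open on the left, into the cell from \<open>grid h k\<close> to
    \<open>grid h (k + 1)\<close>, open on the right. Both of its ends are within \<open>h\<close>
    of the reflected point, and the average of the two deviations obeys the same bound.\<close>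
  define k where "k = m - Suc l"
  have m: "m = l + k + 1" using \<open>l < m\<close> by (simp add: k_def)
  have bounds: "0 \<le> grid h k" "grid h k \<le> grid h m - x" "grid h m - x < grid h (k + 1)"
    "grid h (k + 1) \<le> grid h m" "grid h (k + 1) = grid h k + h"
    using x \<open>0 < h\<close> by (auto simp: grid_def m algebra_simps)
  have "\<bar>B (grid h m - x) $ r $ j - B (grid h k) $ r $ j\<bar> \<le> modulus B h T"
       "\<bar>B (grid h m - x) $ r $ j - B (grid h (k + 1)) $ r $ j\<bar> \<le> modulus B h T"
    using bounds assms(2,3) by (intro abs_diff_le_modulus bdd; auto)+
  moreover have "midvalue h B k $ r $ j = (B (grid h (k + 1)) $ r $ j + B (grid h k) $ r $ j) / 2"
    by (simp add: midvalue_def)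
  ultimately show ?thesis unfolding k_def[symmetric] by (simp add: abs_le_iff field_simps)
qed

lemma frobenius_norm_le_card_mult:
  fixes M :: "real^'s^'s"
  assumes "\<And>i j. \<bar>M $ i $ j\<bar> \<le> c"
  shows "frobenius_norm M \<le> real CARD('s) * c"
proof -
  \<comment> \<open>Here \<open>undefined\<close> is just some index of the nonempty type; any entry
    forces \<open>c\<close> to be nonnegative.\<close>
  have "0 \<le> c" using assms[of undefined undefined] by linarith
  have "(\<Sum>i\<in>UNIV. \<Sum>j\<in>UNIV. \<bar>M $ i $ j\<bar>\<^sup>2) \<le> (\<Sum>i\<in>(UNIV::'s set). \<Sum>j\<in>(UNIV::'s set). c\<^sup>2)"
    using assms by (intro sum_mono power_mono) auto
  also have "\<dots> = (real CARD('s) * c)\<^sup>2"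
    by (simp add: power2_eq_square)
  finally show ?thesis
    unfolding frobenius_norm_def using \<open>0 \<le> c\<close> by (intro real_le_lsqrt) auto
qed

theorem proposition3p1:
  fixes A B :: "real \<Rightarrow> real^'s^'s" and h T :: real and m :: nat
  assumes A_right_cont: "\<And>i j t. 0 \<le> t \<Longrightarrow> continuous (at_right t) (\<lambda>x. A x $ i $ j)"
    and A_bv: "\<And>i j b. 0 \<le> b \<Longrightarrow> bounded_variation (\<lambda>x. A x $ i $ j) 0 b"
    and A_zero: "A 0 = 0"
    and B_meas: "\<And>i j. (\<lambda>x. B x $ i $ j) \<in> borel_measurable (restrict_space borel {0..})"
    and B_bdd: "\<And>i j a b. 0 \<le> a \<Longrightarrow> bounded ((\<lambda>x. B x $ i $ j) ` {a..b})"
    and h_pos: "0 < h"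
    and T_pos: "0 < T"
    and m_le: "grid h m \<le> T"
  shows "(\<forall>i j. \<bar>discretization_error h A B m $ i $ j\<bar>
            \<le> modulus B h T * (\<Sum>r\<in>UNIV. total_variation (\<lambda>x. A x $ i $ r) 0 T))
    \<and> frobenius_norm (discretization_error h A B m)
        \<le> real CARD('s) * max_row_variation A T * modulus B h T
    \<and> (\<forall>L. (\<forall>r j. \<forall>t\<in>{0..T}. \<forall>u\<in>{0..T}. \<bar>B t $ r $ j - B u $ r $ j\<bar> \<le> L * \<bar>t - u\<bar>) \<longrightarrow>
          real CARD('s) * max_row_variation A T * modulus B h T
            \<le> real CARD('s) * max_row_variation A T * L * h)"
proof -
  have bdd: "bounded ((\<lambda>x. B x $ i $ j) ` {0..T})" for i j
    using B_bdd by simp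
  have TV_nonneg: "0 \<le> total_variation (\<lambda>x. A x $ i $ r) 0 T" for i r
    using A_bv[of T i r] T_pos by (intro total_variation_nonneg) auto
  have modulus_nonneg: "0 \<le> modulus B h T"
    using abs_diff_le_modulus[OF bdd, of 0 0 h undefined undefined] h_pos T_pos by simp
  have row_le: "(\<Sum>r\<in>UNIV. total_variation (\<lambda>x. A x $ i $ r) 0 T) \<le> max_row_variation A T" for i
    unfolding max_row_variation_def by (intro Max_ge) auto
  have row_nonneg: "0 \<le> max_row_variation A T"
    by (rule order_trans[OF sum_nonneg row_le]) (simp add: TV_nonneg)
  have grid: "mono (grid h)" "grid h 0 = 0"
    using h_pos by (auto simp: grid_def mono_def)
  have entry: "\<bar>LS_integral (\<lambda>x. A x $ i $ r) {0..grid h m} (\<lambda>x. B (grid h m - x) $ r $ j)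
      - (\<Sum>l<m. midvalue h B (m - Suc l) $ r $ j * (A (grid h (Suc l)) $ i $ r - A (grid h l) $ i $ r))\<bar>
      \<le> modulus B h T * total_variation (\<lambda>x. A x $ i $ r) 0 T" for i r j
  proof -
    \<comment> \<open>Measurability of \<open>B\<close> is given on the half-line only, while the
      integral estimate asks for a Borel function on the whole line. Extension by zero leaves the
      integral over \<open>[0, grid h m]\<close> unchanged, as \<open>grid h m - x\<close> is
      nonnegative there.\<close>
    define b where "b y = indicator {0..} y * B y $ r $ j" for y :: real
    have b_meas: "b \<in> borel_measurable borel"
      using B_meas[of r j] unfolding b_def
      by (subst (asm) borel_measurable_restrict_space_iff) auto
    have LS: "LS_integral (\<lambda>x. A x $ i $ r) {0..grid h m} (\<lambda>x. B (grid h m - x) $ r $ j)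
        = LS_integral (\<lambda>x. A x $ i $ r) {0..grid h m} (\<lambda>x. b (grid h m - x))"
      by (rule LS_integral_cong) (auto simp: b_def)
    have "\<bar>LS_integral (\<lambda>x. A x $ i $ r) {0..grid h m} (\<lambda>x. b (grid h m - x))
      - (\<Sum>l<m. midvalue h B (m - Suc l) $ r $ j * (A (grid h (Suc l)) $ i $ r - A (grid h l) $ i $ r))\<bar>
      \<le> modulus B h T * total_variation (\<lambda>x. A x $ i $ r) 0 (grid h m)"
    proof (rule LS_integral_near_step)
      show "(\<lambda>x. b (grid h m - x)) \<in> borel_measurable borel"
        using b_meas by measurable
      fix l x assume l: "l < m" and x: "x \<in> {grid h l<..grid h (Suc l)}"
      have "grid h (Suc l) \<le> grid h m"
        using l by (intro monoD[OF grid(1)]) simp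
      then have "b (grid h m - x) = B (grid h m - x) $ r $ j"
        using x by (simp add: b_def)
      then show "\<bar>b (grid h m - x) - midvalue h B (m - Suc l) $ r $ j\<bar> \<le> modulus B h T"
        using midvalue_near[OF bdd h_pos m_le l x] by simp
    qed (use A_bv A_zero A_right_cont grid in auto)
    \<comment> \<open>Passing from \<open>grid h m\<close> to \<open>T\<close> only enlarges the
      variation, and the modulus is nonnegative.\<close>
    also have "\<dots> \<le> modulus B h T * total_variation (\<lambda>x. A x $ i $ r) 0 T"
      using modulus_nonneg A_bv[of T i r] T_pos m_le monoD[OF grid(1), of 0 m] grid(2)
      by (intro mult_left_mono total_variation_mono) auto
    finally show ?thesis unfolding LS .
  qed
  have bound: "\<bar>discretization_error h A B m $ i $ j\<bar>
      \<le> modulus B h T * (\<Sum>r\<in>UNIV. total_variation (\<lambda>x. A x $ i $ r) 0 T)" for i j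
  proof -
    have "discretization_error h A B m $ i $ j =
      (\<Sum>r\<in>UNIV. LS_integral (\<lambda>x. A x $ i $ r) {0..grid h m} (\<lambda>x. B (grid h m - x) $ r $ j)
      - (\<Sum>l<m. midvalue h B (m - Suc l) $ r $ j * (A (grid h (Suc l)) $ i $ r - A (grid h l) $ i $ r)))"
      by (simp add: discretization_error_def stieltjes_conv_def
          discrete_conv_increment_component sum_subtractf)
    also have "\<bar>\<dots>\<bar> \<le> (\<Sum>r\<in>UNIV. modulus B h T * total_variation (\<lambda>x. A x $ i $ r) 0 T)"
      by (rule order_trans[OF sum_abs sum_mono]) (rule entry)
    finally show ?thesis by (simp only: sum_distrib_left)
  qed
  moreover have "frobenius_norm (discretization_error h A B m)
      \<le> real CARD('s) * max_row_variation A T * modulus B h T"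
  proof -
    have "\<bar>discretization_error h A B m $ i $ j\<bar> \<le> max_row_variation A T * modulus B h T" for i j
      using order_trans[OF bound[of i j] mult_left_mono[OF row_le[of i] modulus_nonneg]]
      by (simp only: mult.commute)
    from frobenius_norm_le_card_mult[OF this] show ?thesis
      by (simp only: mult.assoc)
  qed
  moreover have "real CARD('s) * max_row_variation A T * modulus B h T
            \<le> real CARD('s) * max_row_variation A T * L * h"
    if L: "\<forall>r j. \<forall>t\<in>{0..T}. \<forall>u\<in>{0..T}. \<bar>B t $ r $ j - B u $ r $ j\<bar> \<le> L * \<bar>t - u\<bar>" for L
  proof -
    \<comment> \<open>The sign of \<open>L\<close> is not assumed; comparing the values at the
      distinct points \<open>T\<close> and \<open>0\<close> yields \<open>0 \<le> L\<close>.\<close>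
    have "0 \<le> \<bar>B T $ undefined $ undefined - B 0 $ undefined $ undefined\<bar>" by simp
    also have "\<dots> \<le> L * \<bar>T - 0\<bar>" using L T_pos by fastforce
    finally have "0 \<le> L" using T_pos by (simp add: zero_le_mult_iff)
    have "modulus B h T \<le> L * h"
    proof (rule modulus_le)
      fix r j t u assume "t \<in> {0..T}" "u \<in> {0..T}" and h: "\<bar>t - u\<bar> \<le> h"
      then have "\<bar>B t $ r $ j - B u $ r $ j\<bar> \<le> L * \<bar>t - u\<bar>" using L by blast
      also have "\<dots> \<le> L * h" using h \<open>0 \<le> L\<close> by (rule mult_left_mono)
      finally show "\<bar>B t $ r $ j - B u $ r $ j\<bar> \<le> L * h" .
    qed (use T_pos h_pos in auto)
    then have "real CARD('s) * max_row_variation A T * modulus B h T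
        \<le> real CARD('s) * max_row_variation A T * (L * h)"
      using row_nonneg by (intro mult_left_mono) auto
    then show ?thesis by (simp add: mult.assoc)
  qed
  ultimately show ?thesis by blast
qed

end
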